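(* Let $\widehat{A}=A+\epsilon B\in\mathbb{DR}^{n\times n}$ with $\operatorname{Ind}(A)=m$, let $$A=U\begin{bmatrix} T_1 & T_2 \\ O & N \end{bmatrix}U^{T},\qquad B=U\begin{bmatrix} B_1 & B_2 \\ B_3 & B_4 \end{bmatrix}U^{T},$$ where $U\in\mathbb{R}^{n\times n}$ is unitary (orthogonal), $T_1\in\mathbb{R}^{r\times r}$ is nonsingular with $r=\operatorname{rank}(A^m)$, $N\in\mathbb{R}^{(n-r)\times(n-r)}$ is nilpotent of nilpotency index $m$, and $B_1\in\mathbb{R}^{r\times r}$, $B_4\in\mathbb{R}^{(n-r)\times(n-r)}$. Suppose the dual core-EP generalized inverse $\widehat{A}^{\dagger_c}$ of $\widehat{A}$ exists. Then $$\widehat{A}^{\dagger_c}=U\begin{bmatrix} T_1^{-1} & O \\ O & O \end{bmatrix}U^{T}+\epsilon\,U\begin{bmatrix} -T_1^{-1}B_1T_1^{-1}-T_1^{-1}T_2\sum_{i=1}^{m}N^{m-i}B_3T_1^{i-m-2} & T_1^{-1}\left(\sum_{i=1}^{m}N^{m-i}B_3T_1^{i-m-1}\right)^{T} \\ \sum_{i=1}^{m}N^{m-i}B_3T_1^{i-m-2} & O \end{bmatrix}U^{T}.$$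
   Context: Dual numbers are $a+\epsilon b$ with $a,b\in\mathbb{R}$, $\epsilon\neq 0$, $\epsilon^2=0$. $\mathbb{DR}^{n\times n}$ is the set of dual real matrices $\widehat{A}=A+\epsilon B$, $A,B\in\mathbb{R}^{n\times n}$, with product $(A+\epsilon B)(C+\epsilon D)=AC+\epsilon(AD+BC)$ and transpose $(A+\epsilon B)^T=A^T+\epsilon B^T$. $\operatorname{Ind}(A)$ is the smallest nonnegative integer $s$ with $\operatorname{rank}(A^{s+1})=\operatorname{rank}(A^s)$. For $\widehat{A}=A+\epsilon B$ with $\operatorname{Ind}(A)=m$, the dual core-EP generalized inverse $\widehat{A}^{\dagger_c}$ is the $\widehat{X}\in\mathbb{DR}^{n\times n}$ (unique if it exists) with $(\widehat{A}\widehat{X})^{T}=\widehat{A}\widehat{X}$, $\widehat{A}\widehat{X}^{2}=\widehat{X}$, $\widehat{X}\widehat{A}^{m+1}=\widehat{A}^{m}$. *)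

theory Defs
  imports
    "Jordan_Normal_Form.Matrix"
    "Jordan_Normal_Form.DL_Rank"
    "Jordan_Normal_Form.Gauss_Jordan_Elimination"
begin

text \<open>Matrices are those of the type \<^typ>\<open>real mat\<close>, whose dimensions are natural numbers and may
  be zero; this is needed because the blocks of size \<open>r\<close> and \<open>n - r\<close> below can be empty.\<close>

subsection \<open>Real matrices\<close>

definition mat_index :: "real mat \<Rightarrow> nat" where
  "mat_index A = (LEAST s. vec_space.rank (dim_row A) (A ^\<^sub>m (s + 1))
                         = vec_space.rank (dim_row A) (A ^\<^sub>m s))"

text \<open>The library predicate \<^const>\<open>orthogonal_mat\<close> only asks for pairwise orthogonal nonzero columns,
  not for orthonormal ones.\<close>
definition real_unitary_mat :: "real mat \<Rightarrow> bool" where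
  "real_unitary_mat U \<longleftrightarrow>
     square_mat U \<and> inverts_mat (transpose_mat U) U \<and> inverts_mat U (transpose_mat U)"

definition nilpotent_mat :: "real mat \<Rightarrow> bool" where
  "nilpotent_mat N \<longleftrightarrow> square_mat N \<and> (\<exists>k. N ^\<^sub>m k = 0\<^sub>m (dim_row N) (dim_row N))"

text \<open>The empty matrix has nilpotency index \<open>0\<close>.\<close>
definition nilpotency_index :: "real mat \<Rightarrow> nat" where
  "nilpotency_index N = (LEAST k. N ^\<^sub>m k = 0\<^sub>m (dim_row N) (dim_row N))"

text \<open>The inverse and the integer powers are meaningful for invertible matrices only.\<close>
definition mat_inv :: "real mat \<Rightarrow> real mat" where
  "mat_inv A = the (mat_inverse A)"

definition mat_powi :: "real mat \<Rightarrow> int \<Rightarrow> real mat" where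
  "mat_powi A k = (if k \<ge> 0 then A ^\<^sub>m nat k else mat_inv A ^\<^sub>m nat (- k))"

subsection \<open>Dual real matrices\<close>

text \<open>\<open>A +\<^sub>\<epsilon> B\<close> stands for the dual matrix with standard part \<open>A\<close> and infinitesimal part \<open>B\<close>.\<close>
datatype dual_mat = Dual_Mat (std_part: "real mat") (inf_part: "real mat") (infix "+\<^sub>\<epsilon>" 60)

definition dual_carrier_mat :: "nat \<Rightarrow> dual_mat set" where
  "dual_carrier_mat n = {A +\<^sub>\<epsilon> B | A B. A \<in> carrier_mat n n \<and> B \<in> carrier_mat n n}"

fun dual_mult :: "dual_mat \<Rightarrow> dual_mat \<Rightarrow> dual_mat" (infixl "*\<^sub>\<epsilon>" 70) where
  "(A +\<^sub>\<epsilon> B) *\<^sub>\<epsilon> (C +\<^sub>\<epsilon> D) = (A * C +\<^sub>\<epsilon> (A * D + B * C))"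

fun dual_transpose :: "dual_mat \<Rightarrow> dual_mat" where
  "dual_transpose (A +\<^sub>\<epsilon> B) = (transpose_mat A +\<^sub>\<epsilon> transpose_mat B)"

definition dual_one :: "nat \<Rightarrow> dual_mat" where
  "dual_one n = (1\<^sub>m n +\<^sub>\<epsilon> 0\<^sub>m n n)"

fun dual_pow :: "dual_mat \<Rightarrow> nat \<Rightarrow> dual_mat" (infixr "^\<^sub>\<epsilon>" 75) where
  "X ^\<^sub>\<epsilon> 0 = dual_one (dim_row (std_part X))"
| "X ^\<^sub>\<epsilon> Suc k = X ^\<^sub>\<epsilon> k *\<^sub>\<epsilon> X"

definition is_dual_core_EP_inverse :: "dual_mat \<Rightarrow> dual_mat \<Rightarrow> bool" where
  "is_dual_core_EP_inverse A X \<longleftrightarrow>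
     (let m = mat_index (std_part A) in
        X \<in> dual_carrier_mat (dim_row (std_part A)) \<and>
        dual_transpose (A *\<^sub>\<epsilon> X) = A *\<^sub>\<epsilon> X \<and>
        A *\<^sub>\<epsilon> X ^\<^sub>\<epsilon> 2 = X \<and>
        X *\<^sub>\<epsilon> A ^\<^sub>\<epsilon> (m + 1) = A ^\<^sub>\<epsilon> m)"

definition dual_core_EP_inverse :: "dual_mat \<Rightarrow> dual_mat" where
  "dual_core_EP_inverse A = (THE X. is_dual_core_EP_inverse A X)"

end

theory Submission
  imports Defs
begin

text \<open>
  Let \<open>X\<close> be a core-EP inverse of the dual matrix \<open>\<A> = A + \<epsilon>B\<close>. The proof determines the dual matrix
  \<open>P = \<A>X\<close> first and then reads off \<open>X\<close>.

  In any monoid with involution the three defining equations make \<open>P\<close> a self-adjoint idempotent that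
  fixes \<open>\<A>\<^sup>m\<close>, and they give \<open>PX = X = XP\<close>. They also determine \<open>X\<close> uniquely: each of two
  candidates for \<open>P\<close> fixes \<open>\<A>\<^sup>m\<close> and has \<open>\<A>\<^sup>m\<close> as a left factor, so that they absorb each other, and
  self-adjoint idempotents which absorb each other are equal (\<open>core_EP_inverse_unique\<close>).
  The identities for \<open>P\<close> are used for dual matrices, uniqueness for real ones. Since conjugation by an
  orthogonal matrix respects the three equations, it suffices to treat \<open>A\<close> and \<open>B\<close> in block form.

  The standard part of \<open>X\<close> is a core-EP inverse of \<open>A\<close>, and \<open>diag(T\<^sub>1\<^sup>-\<^sup>1, 0)\<close> is one too because
  \<open>N\<^sup>m = 0\<close>, so they agree; hence \<open>P = diag(1, 0) + \<epsilon>D\<close>. Idempotence kills the diagonal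
  blocks of \<open>D\<close>, and symmetry makes its upper right block the transpose of its
  lower left block \<open>K\<close>. To find \<open>K\<close>, compare the lower left blocks of the infinitesimal parts of \<open>P\<A>\<^sup>m = \<A>\<^sup>m\<close>. On the right, the infinitesimal part is the sum
  of \<open>A\<^sup>j B A\<^sup>m\<^sup>-\<^sup>1\<^sup>-\<^sup>j\<close> over \<open>j < m\<close>; as \<open>A\<close> is block upper triangular, the comparison reads
  \<open>K T\<^sub>1\<^sup>m = \<Sum>\<^sub>j N\<^sup>j B\<^sub>3 T\<^sub>1\<^sup>m\<^sup>-\<^sup>1\<^sup>-\<^sup>j\<close> (\<open>dual_pow_blocks\<close>). So \<open>K\<close> is the sum with the powers
  \<open>T\<^sub>1\<^sup>i\<^sup>-\<^sup>m\<^sup>-\<^sup>1\<close>. Finally \<open>PX = X\<close> gives the lower blocks of the infinitesimal part of \<open>X\<close>,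
  \<open>XP = X\<close> the upper right block,
  and \<open>\<A>X = P\<close> the upper left block (\<open>dual_core_EP_inverse_block\<close>).
\<close>

section \<open>Core-EP inverses in a monoid with involution\<close>

locale star_monoid = monoid G for G (structure) +
  fixes star :: "'a \<Rightarrow> 'a"
  assumes star_closed [simp]: "x \<in> carrier G \<Longrightarrow> star x \<in> carrier G"
    and star_mult: "\<lbrakk>x \<in> carrier G; y \<in> carrier G\<rbrakk> \<Longrightarrow> star (x \<otimes> y) = star y \<otimes> star x"
    and star_star: "x \<in> carrier G \<Longrightarrow> star (star x) = x"
begin

text \<open>The exponent is a parameter, not the index of \<open>a\<close>, so that conjugating \<open>a\<close> or passing to its
  standard part needs no comparison of indices.\<close>
definition core_EP_inverse :: "nat \<Rightarrow> 'a \<Rightarrow> 'a \<Rightarrow> bool" where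
  "core_EP_inverse m a x \<longleftrightarrow>
     a \<in> carrier G \<and> x \<in> carrier G \<and>
     star (a \<otimes> x) = a \<otimes> x \<and> a \<otimes> (x \<otimes> x) = x \<and> x \<otimes> a [^] Suc m = a [^] m"

context
  fixes m :: nat and a x :: 'a
  assumes core_EP: "core_EP_inverse m a x"
begin

lemma core_EP_closed: "a \<in> carrier G" "x \<in> carrier G"
  and core_EP_selfadjoint: "star (a \<otimes> x) = a \<otimes> x"
  and core_EP_outer: "a \<otimes> (x \<otimes> x) = x"
  and core_EP_power: "x \<otimes> a [^] Suc m = a [^] m"
  using core_EP by (simp_all add: core_EP_inverse_def)

text \<open>Iterating \<open>x = a x\<^sup>2\<close> lets \<open>a\<^sup>m\<close> be split off from \<open>x\<close> and from \<open>a x\<close>. This is what makes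
  \<open>x a\<^sup>m\<^sup>+\<^sup>1 = a\<^sup>m\<close> applicable, which only speaks about products with high powers of \<open>a\<close>.\<close>
lemma core_EP_power_mult_power: "a [^] k \<otimes> x [^] Suc k = x"
proof (induction k)
  case (Suc k)
  have "a [^] Suc k \<otimes> x [^] Suc (Suc k) = a [^] k \<otimes> ((a \<otimes> (x \<otimes> x)) \<otimes> x [^] k)"
    by (simp only: nat_pow_Suc[of a] nat_pow_Suc2[of x] core_EP_closed m_assoc m_closed
        nat_pow_closed)
  also have "\<dots> = a [^] k \<otimes> x [^] Suc k"
    by (simp only: core_EP_outer nat_pow_Suc2 core_EP_closed)
  finally show ?case using Suc by simp
qed (simp add: core_EP_closed)

lemma core_EP_projection_eq: "a \<otimes> x = a [^] Suc k \<otimes> x [^] Suc k"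
proof -
  have "a \<otimes> x = a \<otimes> (a [^] k \<otimes> x [^] Suc k)" by (simp only: core_EP_power_mult_power)
  also have "\<dots> = a [^] Suc k \<otimes> x [^] Suc k"
    by (simp only: nat_pow_Suc2[of a k] m_assoc core_EP_closed nat_pow_closed)
  finally show ?thesis .
qed

lemma core_EP_projection_power: "(a \<otimes> x) \<otimes> a [^] m = a [^] m"
proof -
  have "(a \<otimes> x) \<otimes> a [^] m = (a \<otimes> (x \<otimes> x)) \<otimes> a [^] Suc m"
    by (subst core_EP_power[symmetric]) (simp add: m_assoc core_EP_closed)
  then show ?thesis by (simp only: core_EP_outer core_EP_power)
qed

lemma core_EP_projection_mult: "(a \<otimes> x) \<otimes> x = x"
  using core_EP_outer by (simp add: m_assoc core_EP_closed)

lemma core_EP_mult_projection: "x \<otimes> (a \<otimes> x) = x"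
proof -
  have "x \<otimes> (a \<otimes> x) = x \<otimes> a [^] Suc m \<otimes> x [^] Suc m"
    by (simp only: core_EP_projection_eq[of m] m_assoc core_EP_closed nat_pow_closed)
  also have "\<dots> = x" by (simp only: core_EP_power core_EP_power_mult_power)
  finally show ?thesis .
qed

lemma core_EP_projection_idem: "(a \<otimes> x) \<otimes> (a \<otimes> x) = a \<otimes> x"
  by (simp add: m_assoc core_EP_closed core_EP_mult_projection)

end

text \<open>The right factor \<open>a y\<close> starts with \<open>a\<^sup>m\<close>, which the left factor \<open>a x\<close> fixes.\<close>
lemma core_EP_projection_absorb:
  assumes x: "core_EP_inverse m a x" and y: "core_EP_inverse m a y"
  shows "(a \<otimes> x) \<otimes> (a \<otimes> y) = a \<otimes> y"
proof -
  note [simp] = core_EP_closed[OF x] core_EP_closed[OF y]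
  have y_eq: "a \<otimes> y = a [^] m \<otimes> (a \<otimes> y [^] Suc m)"
    by (simp add: core_EP_projection_eq[OF y, of m] m_assoc)
  have "(a \<otimes> x) \<otimes> (a \<otimes> y) = ((a \<otimes> x) \<otimes> a [^] m) \<otimes> (a \<otimes> y [^] Suc m)"
    unfolding y_eq by (simp add: m_assoc)
  then show ?thesis by (simp only: core_EP_projection_power[OF x] y_eq[symmetric])
qed

text \<open>By mutual absorption and self-adjointness \<open>a x\<close> and \<open>a y\<close> are the same projection; then both
  \<open>x\<close> and \<open>y\<close> equal \<open>a\<^sup>m y\<^sup>m\<^sup>+\<^sup>1\<close>.\<close>
lemma core_EP_inverse_unique:
  assumes x: "core_EP_inverse m a x" and y: "core_EP_inverse m a y"
  shows "x = y"
proof -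
  note [simp] = core_EP_closed[OF x] core_EP_closed[OF y]
  have "a \<otimes> x = star ((a \<otimes> y) \<otimes> (a \<otimes> x))"
    by (simp only: core_EP_projection_absorb[OF y x] core_EP_selfadjoint[OF x])
  also have "\<dots> = (a \<otimes> x) \<otimes> (a \<otimes> y)"
    by (subst star_mult) (simp_all only: m_closed core_EP_closed[OF x] core_EP_closed[OF y]
        core_EP_selfadjoint[OF x] core_EP_selfadjoint[OF y])
  also have "\<dots> = a \<otimes> y" by (rule core_EP_projection_absorb[OF x y])
  finally have same_projection: "a \<otimes> x = a \<otimes> y" .
  have "x = x \<otimes> (a \<otimes> y)"
    using core_EP_mult_projection[OF x] same_projection by simp
  also have "\<dots> = x \<otimes> a [^] Suc m \<otimes> y [^] Suc m"
    by (simp only: core_EP_projection_eq[OF y, of m] m_assoc core_EP_closed[OF x]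
        core_EP_closed[OF y] nat_pow_closed)
  also have "\<dots> = y"
    by (simp only: core_EP_power[OF x] core_EP_power_mult_power[OF y])
  finally show ?thesis .
qed

context
  fixes u v :: 'a
  assumes uv: "u \<in> carrier G" "v \<in> carrier G" "u \<otimes> v = \<one>" "v \<otimes> u = \<one>"
begin

lemma conjugate_mult:
  assumes "a \<in> carrier G" "b \<in> carrier G"
  shows "(v \<otimes> a \<otimes> u) \<otimes> (v \<otimes> b \<otimes> u) = v \<otimes> (a \<otimes> b) \<otimes> u"
proof -
  have "(v \<otimes> a \<otimes> u) \<otimes> (v \<otimes> b \<otimes> u) = v \<otimes> a \<otimes> (u \<otimes> v) \<otimes> (b \<otimes> u)"
    using assms uv(1,2) by (simp only: m_assoc m_closed)
  then show ?thesis using assms uv by (simp add: m_assoc)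
qed

lemma conjugate_pow:
  assumes "a \<in> carrier G"
  shows "(v \<otimes> a \<otimes> u) [^] (k :: nat) = v \<otimes> a [^] k \<otimes> u"
proof (induction k)
  case (Suc k)
  then show ?case using assms conjugate_mult[of "a [^] k" a] by simp
qed (use uv in simp)

text \<open>Conjugation by a unit is an automorphism of the monoid; the condition \<open>v = star u\<close> makes it
  commute with the involution.\<close>
lemma core_EP_inverse_conjugate:
  assumes v: "v = star u" and x: "core_EP_inverse m a x"
  shows "core_EP_inverse m (v \<otimes> a \<otimes> u) (v \<otimes> x \<otimes> u)"
proof -
  note [simp] = core_EP_closed[OF x] uv(1,2)
  have "star (v \<otimes> (a \<otimes> x) \<otimes> u) = v \<otimes> star (a \<otimes> x) \<otimes> u"
    using uv(1) by (simp add: v star_mult star_star m_assoc)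
  then have "star (v \<otimes> a \<otimes> u \<otimes> (v \<otimes> x \<otimes> u)) = v \<otimes> a \<otimes> u \<otimes> (v \<otimes> x \<otimes> u)"
    by (simp only: conjugate_mult core_EP_closed[OF x] core_EP_selfadjoint[OF x])
  moreover have "v \<otimes> a \<otimes> u \<otimes> (v \<otimes> x \<otimes> u \<otimes> (v \<otimes> x \<otimes> u)) = v \<otimes> x \<otimes> u"
    by (simp only: conjugate_mult m_closed core_EP_closed[OF x] core_EP_outer[OF x])
  moreover have "v \<otimes> x \<otimes> u \<otimes> (v \<otimes> a \<otimes> u) [^] Suc m = (v \<otimes> a \<otimes> u) [^] m"
    by (simp only: conjugate_pow conjugate_mult nat_pow_closed core_EP_closed[OF x]
        core_EP_power[OF x])
  ultimately show ?thesis by (simp add: core_EP_inverse_def del: nat_pow_Suc)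
qed

end

end

section \<open>Real and dual matrices as monoids with involution\<close>

abbreviation real_mat_ring :: "nat \<Rightarrow> real mat ring" where
  "real_mat_ring n \<equiv> ring_mat TYPE(real) n ()"

lemma star_monoid_real_mat: "star_monoid (real_mat_ring n) transpose_mat"
proof -
  interpret ring "real_mat_ring n" by (rule ring_mat)
  show ?thesis
    by unfold_locales (auto simp: ring_mat_simps transpose_mult)
qed

definition dual_mat_monoid :: "nat \<Rightarrow> dual_mat monoid" where
  "dual_mat_monoid n = \<lparr>carrier = dual_carrier_mat n, mult = dual_mult, one = dual_one n\<rparr>"

lemma dual_mat_monoid_simps:
  "carrier (dual_mat_monoid n) = dual_carrier_mat n"
  "mult (dual_mat_monoid n) = dual_mult"
  "one (dual_mat_monoid n) = dual_one n"
  by (simp_all add: dual_mat_monoid_def)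

lemma dual_carrier_mat_iff [simp]:
  "(A +\<^sub>\<epsilon> B) \<in> dual_carrier_mat n \<longleftrightarrow> A \<in> carrier_mat n n \<and> B \<in> carrier_mat n n"
  by (auto simp: dual_carrier_mat_def)

lemma dual_carrier_matE:
  assumes "X \<in> dual_carrier_mat n"
  obtains G H where "X = G +\<^sub>\<epsilon> H" "G \<in> carrier_mat n n" "H \<in> carrier_mat n n"
  using assms by (auto simp: dual_carrier_mat_def)

lemma dual_mult_assoc:
  assumes "X \<in> dual_carrier_mat n" "Y \<in> dual_carrier_mat n" "Z \<in> dual_carrier_mat n"
  shows "X *\<^sub>\<epsilon> Y *\<^sub>\<epsilon> Z = X *\<^sub>\<epsilon> (Y *\<^sub>\<epsilon> Z)"
proof -
  obtain A B where X: "X = A +\<^sub>\<epsilon> B" "A \<in> carrier_mat n n" "B \<in> carrier_mat n n"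
    using assms(1) by (rule dual_carrier_matE)
  obtain C D where Y: "Y = C +\<^sub>\<epsilon> D" "C \<in> carrier_mat n n" "D \<in> carrier_mat n n"
    using assms(2) by (rule dual_carrier_matE)
  obtain E F where Z: "Z = E +\<^sub>\<epsilon> F" "E \<in> carrier_mat n n" "F \<in> carrier_mat n n"
    using assms(3) by (rule dual_carrier_matE)
  note c = X(2,3) Y(2,3) Z(2,3) and [simp] = mult_carrier_mat[of _ n n _ n]
  have "A * C * F + (A * D + B * C) * E = A * C * F + (A * D * E + B * C * E)"
    using c by (simp add: add_mult_distrib_mat[of _ n n _ _ n])
  also have "\<dots> = A * (C * F) + A * (D * E) + B * (C * E)"
    using c by (simp add: assoc_add_mat[of _ n n] assoc_mult_mat[of _ n n _ n _ n])
  also have "\<dots> = A * (C * F + D * E) + B * (C * E)"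
    using c by (simp add: mult_add_distrib_mat[of _ n n _ n])
  finally show ?thesis using c by (simp add: X Y Z assoc_mult_mat[of _ n n _ n _ n])
qed

lemma star_monoid_dual_mat: "star_monoid (dual_mat_monoid n) dual_transpose"
proof
  fix X Y assume "X \<in> carrier (dual_mat_monoid n)" "Y \<in> carrier (dual_mat_monoid n)"
  then have XY: "X \<in> dual_carrier_mat n" "Y \<in> dual_carrier_mat n"
    by (simp_all add: dual_mat_monoid_simps)
  obtain A B where X: "X = A +\<^sub>\<epsilon> B" "A \<in> carrier_mat n n" "B \<in> carrier_mat n n"
    using XY(1) by (rule dual_carrier_matE)
  obtain C D where Y: "Y = C +\<^sub>\<epsilon> D" "C \<in> carrier_mat n n" "D \<in> carrier_mat n n"
    using XY(2) by (rule dual_carrier_matE)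
  note c = X(2,3) Y(2,3) and [simp] = mult_carrier_mat[of _ n n _ n]
  show "X \<otimes>\<^bsub>dual_mat_monoid n\<^esub> Y \<in> carrier (dual_mat_monoid n)"
    using c by (simp add: dual_mat_monoid_simps X Y)
  show "dual_transpose (X \<otimes>\<^bsub>dual_mat_monoid n\<^esub> Y)
      = dual_transpose Y \<otimes>\<^bsub>dual_mat_monoid n\<^esub> dual_transpose X"
    using c by (simp add: dual_mat_monoid_simps X Y transpose_mult[of _ n n _ n]
        transpose_add[of _ n n] comm_add_mat[of _ n n])
next
  fix X Y Z
  assume "X \<in> carrier (dual_mat_monoid n)" "Y \<in> carrier (dual_mat_monoid n)"
    "Z \<in> carrier (dual_mat_monoid n)"
  then show "X \<otimes>\<^bsub>dual_mat_monoid n\<^esub> Y \<otimes>\<^bsub>dual_mat_monoid n\<^esub> Z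
      = X \<otimes>\<^bsub>dual_mat_monoid n\<^esub> (Y \<otimes>\<^bsub>dual_mat_monoid n\<^esub> Z)"
    by (simp add: dual_mat_monoid_simps dual_mult_assoc)
qed (auto simp: dual_mat_monoid_simps dual_one_def elim!: dual_carrier_matE)

interpretation real_mat: star_monoid "real_mat_ring n" transpose_mat for n
  by (rule star_monoid_real_mat)

interpretation dual_mat: star_monoid "dual_mat_monoid n" dual_transpose for n
  by (rule star_monoid_dual_mat)

lemma dual_pow_eq_monoid_pow:
  assumes "X \<in> dual_carrier_mat n"
  shows "X ^\<^sub>\<epsilon> k = X [^]\<^bsub>dual_mat_monoid n\<^esub> k"
  using assms by (induction k) (auto simp: dual_mat_monoid_simps elim!: dual_carrier_matE)

lemma std_part_dual_mult: "std_part (X *\<^sub>\<epsilon> Y) = std_part X * std_part Y"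
  by (cases X; cases Y) simp

lemma std_part_dual_transpose: "std_part (dual_transpose X) = transpose_mat (std_part X)"
  by (cases X) simp

lemma std_part_dual_pow: "std_part (X ^\<^sub>\<epsilon> k) = std_part X ^\<^sub>m k"
  by (induction k) (simp_all add: dual_one_def std_part_dual_mult)

lemma real_core_EP_inverse_iff:
  assumes "A \<in> carrier_mat n n"
  shows "real_mat.core_EP_inverse n m A X \<longleftrightarrow>
    X \<in> carrier_mat n n \<and> transpose_mat (A * X) = A * X \<and> A * (X * X) = X
      \<and> X * A ^\<^sub>m Suc m = A ^\<^sub>m m"
  using assms
  by (simp only: real_mat.core_EP_inverse_def ring_mat_simps
      pow_mat_ring_pow[of _ n _ "()"] simp_thms)

lemma dual_core_EP_inverse_iff:
  assumes "A \<in> dual_carrier_mat n"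
  shows "dual_mat.core_EP_inverse n m A X \<longleftrightarrow>
    X \<in> dual_carrier_mat n \<and> dual_transpose (A *\<^sub>\<epsilon> X) = A *\<^sub>\<epsilon> X \<and> A *\<^sub>\<epsilon> (X *\<^sub>\<epsilon> X) = X
      \<and> X *\<^sub>\<epsilon> A ^\<^sub>\<epsilon> Suc m = A ^\<^sub>\<epsilon> m"
  using assms
  by (simp add: dual_mat.core_EP_inverse_def dual_mat_monoid_simps dual_pow_eq_monoid_pow
      del: dual_pow.simps)

lemma is_dual_core_EP_inverse_iff:
  assumes "A \<in> carrier_mat n n" "B \<in> carrier_mat n n"
  shows "is_dual_core_EP_inverse (A +\<^sub>\<epsilon> B) X
    \<longleftrightarrow> dual_mat.core_EP_inverse n (mat_index A) (A +\<^sub>\<epsilon> B) X"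
proof -
  have "X ^\<^sub>\<epsilon> 2 = X *\<^sub>\<epsilon> X" if "X \<in> dual_carrier_mat n"
    using that by (auto simp: numeral_2_eq_2 dual_one_def elim!: dual_carrier_matE)
  then show ?thesis
    using assms by (auto simp: is_dual_core_EP_inverse_def dual_core_EP_inverse_iff Let_def
        simp del: dual_pow.simps)
qed

text \<open>Taking standard parts is a homomorphism of monoids with involution.\<close>
lemma std_part_core_EP_inverse:
  assumes "A \<in> dual_carrier_mat n" "dual_mat.core_EP_inverse n m A X"
  shows "real_mat.core_EP_inverse n m (std_part A) (std_part X)"
proof -
  have A: "std_part A \<in> carrier_mat n n" using assms(1) by (auto elim!: dual_carrier_matE)
  note x = assms(2)[unfolded dual_core_EP_inverse_iff[OF assms(1)]]
  have "std_part X \<in> carrier_mat n n" using x by (auto elim!: dual_carrier_matE)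
  moreover have "std_part (dual_transpose (A *\<^sub>\<epsilon> X)) = std_part (A *\<^sub>\<epsilon> X)"
    "std_part (A *\<^sub>\<epsilon> (X *\<^sub>\<epsilon> X)) = std_part X"
    "std_part (X *\<^sub>\<epsilon> A ^\<^sub>\<epsilon> Suc m) = std_part (A ^\<^sub>\<epsilon> m)"
    using x by simp_all
  ultimately show ?thesis
    by (simp add: real_core_EP_inverse_iff[OF A] std_part_dual_mult std_part_dual_transpose
        std_part_dual_pow del: dual_pow.simps pow_mat.simps)
qed

section \<open>Block matrices\<close>

text \<open>A block matrix does not show where it is cut; the common dimensions of the blocks say so.\<close>
lemma four_block_mat_inject:
  assumes "four_block_mat A1 A2 A3 A4 = four_block_mat B1 B2 B3 B4"
    and "A1 \<in> carrier_mat nr1 nc1" "A2 \<in> carrier_mat nr1 nc2"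
      "A3 \<in> carrier_mat nr2 nc1" "A4 \<in> carrier_mat nr2 nc2"
    and "B1 \<in> carrier_mat nr1 nc1" "B2 \<in> carrier_mat nr1 nc2"
      "B3 \<in> carrier_mat nr2 nc1" "B4 \<in> carrier_mat nr2 nc2"
  shows "A1 = B1" "A2 = B2" "A3 = B3" "A4 = B4"
proof -
  have entry: "four_block_mat A1 A2 A3 A4 $$ (i, j) = four_block_mat B1 B2 B3 B4 $$ (i, j)" for i j
    using assms(1) by simp
  note c = assms(2-)
  show "A1 = B1"
  proof (rule eq_matI)
    fix i j assume "i < dim_row B1" "j < dim_col B1"
    then show "A1 $$ (i, j) = B1 $$ (i, j)" using entry[of i j] c by simp
  qed (use c in simp_all)
  show "A2 = B2"
  proof (rule eq_matI)
    fix i j assume "i < dim_row B2" "j < dim_col B2"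
    then show "A2 $$ (i, j) = B2 $$ (i, j)" using entry[of i "j + nc1"] c by simp
  qed (use c in simp_all)
  show "A3 = B3"
  proof (rule eq_matI)
    fix i j assume "i < dim_row B3" "j < dim_col B3"
    then show "A3 $$ (i, j) = B3 $$ (i, j)" using entry[of "i + nr1" j] c by simp
  qed (use c in simp_all)
  show "A4 = B4"
  proof (rule eq_matI)
    fix i j assume "i < dim_row B4" "j < dim_col B4"
    then show "A4 $$ (i, j) = B4 $$ (i, j)" using entry[of "i + nr1" "j + nc1"] c by simp
  qed (use c in simp_all)
qed

lemma four_block_matE:
  assumes "A \<in> carrier_mat (nr1 + nr2) (nc1 + nc2)"
  obtains A1 A2 A3 A4 where "A = four_block_mat A1 A2 A3 A4"
    "A1 \<in> carrier_mat nr1 nc1" "A2 \<in> carrier_mat nr1 nc2"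
    "A3 \<in> carrier_mat nr2 nc1" "A4 \<in> carrier_mat nr2 nc2"
proof -
  obtain A1 A2 A3 A4 where "split_block A nr1 nc1 = (A1, A2, A3, A4)"
    by (cases "split_block A nr1 nc1") auto
  from split_block[OF this, of nr2 nc2] assms that show ?thesis by auto
qed

lemma pow_mat_Suc_left:
  assumes "(A :: real mat) \<in> carrier_mat n n"
  shows "A ^\<^sub>m Suc j = A * A ^\<^sub>m j"
  using real_mat.nat_pow_Suc2[of A n j] assms
  by (simp only: pow_mat_ring_pow[OF assms, of _ "()"] ring_mat_simps)

lemma inverse_pow_mat:
  assumes S: "(S :: real mat) \<in> carrier_mat n n" and T: "T \<in> carrier_mat n n"
    and ST: "S * T = 1\<^sub>m n"
  shows "S ^\<^sub>m j * T ^\<^sub>m j = 1\<^sub>m n"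
proof (induction j)
  case (Suc j)
  note [simp] = mult_carrier_mat[of _ n n _ n]
  have pows: "S ^\<^sub>m j \<in> carrier_mat n n" "T ^\<^sub>m j \<in> carrier_mat n n"
    using S T by (simp_all add: pow_carrier_mat)
  have "S ^\<^sub>m Suc j * T ^\<^sub>m Suc j = S ^\<^sub>m j * S * (T * T ^\<^sub>m j)"
    by (simp only: pow_mat_Suc_left[OF T]) simp
  also have "\<dots> = S ^\<^sub>m j * ((S * T) * T ^\<^sub>m j)"
    using S T pows by (simp add: assoc_mult_mat[of _ n n _ n _ n])
  also have "\<dots> = 1\<^sub>m n" using ST Suc pows by (simp add: left_mult_one_mat[of _ n n])
  finally show ?case .
qed (use assms in simp)

section \<open>The tilt of the invariant subspace\<close>

text \<open>The partial sums \<open>\<Sum> N\<^sup>i C S\<^sup>i\<^sup>+\<^sup>1\<close> over \<open>i < j\<close>. If \<open>S = T\<^sup>-\<^sup>1\<close> and \<open>N\<^sup>j = 0\<close>, this is the solution \<open>K\<close>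
  of the Sylvester equation \<open>K T = C + N K\<close>, which says that the block column with entries
  \<open>1\<close> and \<open>\<epsilon>K\<close> spans an invariant subspace of a block upper triangular matrix with diagonal blocks \<open>T\<close>
  and \<open>N\<close> perturbed by \<open>\<epsilon>C\<close> in the lower left block.\<close>
primrec sylvester_sum :: "real mat \<Rightarrow> real mat \<Rightarrow> real mat \<Rightarrow> nat \<Rightarrow> real mat" where
  "sylvester_sum N C S 0 = 0\<^sub>m (dim_row C) (dim_col C)"
| "sylvester_sum N C S (Suc j) = sylvester_sum N C S j + N ^\<^sub>m j * C * S ^\<^sub>m Suc j"

text \<open>Products of rectangular blocks hide their inner dimension, which the simplifier cannot guess;
  the instances collected here fix it to \<open>k\<close> or \<open>r\<close>.\<close>
locale block_dims =
  fixes k r :: nat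
begin

lemmas block_mult_carrier =
  mult_carrier_mat[of _ k k _ k] mult_carrier_mat[of _ k k _ r]
  mult_carrier_mat[of _ k r _ k] mult_carrier_mat[of _ k r _ r]
  mult_carrier_mat[of _ r k _ k] mult_carrier_mat[of _ r k _ r]
  mult_carrier_mat[of _ r r _ k] mult_carrier_mat[of _ r r _ r]

lemmas block_mult = mult_four_block_mat[where ?nr1.0 = r and ?nr2.0 = k and ?n1.0 = r and ?n2.0 = k
    and ?nc1.0 = r and ?nc2.0 = k]

lemmas block_add = add_four_block_mat[where ?nr1.0 = r and ?nr2.0 = k
    and ?nc1.0 = r and ?nc2.0 = k]

end

locale sylvester_data = block_dims +
  fixes N C S :: "real mat"
  assumes NCS: "N \<in> carrier_mat k k" "C \<in> carrier_mat k r" "S \<in> carrier_mat r r"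
begin

lemma sylvester_sum_carrier [simp]: "sylvester_sum N C S j \<in> carrier_mat k r"
  by (induction j) (use NCS carrier_matD[OF NCS(2)] in \<open>simp_all add: block_mult_carrier pow_carrier_mat\<close>)

text \<open>Reversing the order of summation turns the exponents \<open>m - i\<close> of \<open>N\<close> into a running index.\<close>
lemma finsum_reverse_index:
  fixes f :: "nat \<Rightarrow> real mat"
  assumes "\<And>j. f j \<in> carrier_mat k r"
  shows "(\<Oplus>\<^bsub>module_mat TYPE(real) k r\<^esub> i \<in> {1..m}. f (m - i))
    = (\<Oplus>\<^bsub>module_mat TYPE(real) k r\<^esub> j \<in> {..<m}. f j)"
proof -
  interpret M: abelian_group "module_mat TYPE(real) k r" by (rule abelian_group_mat)
  have image: "(\<lambda>i. m - i) ` {1..m} = {..<m}"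
  proof
    show "{..<m} \<subseteq> (\<lambda>i. m - i) ` {1..m}"
    proof
      fix j assume "j \<in> {..<m}"
      then show "j \<in> (\<lambda>i. m - i) ` {1..m}" by (intro image_eqI[of _ _ "m - j"]) auto
    qed
  qed auto
  have "inj_on (\<lambda>i. m - i) {1..m}" by (auto intro!: inj_onI)
  from M.finsum_reindex[OF _ this, of f] assms show ?thesis
    unfolding image by (simp add: module_mat_simps)
qed

lemma finsum_eq_sylvester_sum:
  "(\<Oplus>\<^bsub>module_mat TYPE(real) k r\<^esub> i \<in> {1..m}. N ^\<^sub>m (m - i) * C * S ^\<^sub>m Suc (m - i))
    = sylvester_sum N C S m"
proof -
  interpret M: abelian_group "module_mat TYPE(real) k r" by (rule abelian_group_mat)
  have term_carrier: "N ^\<^sub>m j * C * S ^\<^sub>m Suc j \<in> carrier_mat k r" for j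
    using NCS by (simp add: block_mult_carrier pow_carrier_mat)
  have "(\<Oplus>\<^bsub>module_mat TYPE(real) k r\<^esub> j \<in> {..<m}. N ^\<^sub>m j * C * S ^\<^sub>m Suc j)
    = sylvester_sum N C S m"
  proof (induction m)
    case 0
    show ?case using NCS carrier_matD[OF NCS(2)] by (simp add: module_mat_simps)
  next
    case (Suc m)
    then show ?case
      using term_carrier
      by (simp add: lessThan_Suc M.finsum_insert module_mat_simps comm_add_mat[of _ k r]
          del: pow_mat.simps)
  qed
  then show ?thesis
    by (subst finsum_reverse_index[of "\<lambda>j. N ^\<^sub>m j * C * S ^\<^sub>m Suc j", OF term_carrier])
qed

lemma finsum_eq_sylvester_sum_mult:
  "(\<Oplus>\<^bsub>module_mat TYPE(real) k r\<^esub> i \<in> {1..m}. N ^\<^sub>m (m - i) * C * S ^\<^sub>m Suc (Suc (m - i)))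
    = sylvester_sum N C S m * S"
proof -
  interpret M: abelian_group "module_mat TYPE(real) k r" by (rule abelian_group_mat)
  have term_carrier: "N ^\<^sub>m j * C * S ^\<^sub>m j' \<in> carrier_mat k r" for j j'
    using NCS by (simp add: block_mult_carrier pow_carrier_mat)
  have "(\<Oplus>\<^bsub>module_mat TYPE(real) k r\<^esub> j \<in> {..<m}. N ^\<^sub>m j * C * S ^\<^sub>m Suc (Suc j))
    = sylvester_sum N C S m * S"
  proof (induction m)
    case 0
    show ?case using NCS carrier_matD[OF NCS(2)] by (simp add: module_mat_simps left_mult_zero_mat[of S r r])
  next
    case (Suc m)
    have split_power: "N ^\<^sub>m m * C * S ^\<^sub>m Suc (Suc m) = N ^\<^sub>m m * C * S ^\<^sub>m Suc m * S"
      using NCS by (simp add: block_mult_carrier pow_carrier_mat assoc_mult_mat[of _ k r _ r _ r])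
    have "sylvester_sum N C S (Suc m) * S
      = sylvester_sum N C S m * S + N ^\<^sub>m m * C * S ^\<^sub>m Suc m * S"
      using NCS term_carrier
      by (simp add: add_mult_distrib_mat[of _ k r _ _ r] del: pow_mat.simps)
    also have "\<dots> = N ^\<^sub>m m * C * S ^\<^sub>m Suc (Suc m) + sylvester_sum N C S m * S"
      unfolding split_power[symmetric]
      by (rule comm_add_mat[of _ k r])
        (use NCS in \<open>simp_all add: block_mult_carrier term_carrier del: pow_mat.simps\<close>)
    finally show ?case
      using term_carrier Suc.IH
      by (simp add: lessThan_Suc M.finsum_insert module_mat_simps del: pow_mat.simps sylvester_sum.simps)
  qed
  then show ?thesis
    by (subst finsum_reverse_index[of "\<lambda>j. N ^\<^sub>m j * C * S ^\<^sub>m Suc (Suc j)", OF term_carrier])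
qed

end

locale dual_block = block_dims +
  fixes T T2 N B1 B2 B3 B4 S :: "real mat"
  assumes blocks: "T \<in> carrier_mat r r" "T2 \<in> carrier_mat r k" "N \<in> carrier_mat k k"
      "B1 \<in> carrier_mat r r" "B2 \<in> carrier_mat r k" "B3 \<in> carrier_mat k r" "B4 \<in> carrier_mat k k"
      "S \<in> carrier_mat r r"
    and inverse: "S * T = 1\<^sub>m r" "T * S = 1\<^sub>m r"
begin

sublocale sylvester_data k r N B3 S
  by unfold_locales (rule blocks)+

definition F :: "real mat" where "F = four_block_mat T T2 (0\<^sub>m k r) N"
definition E :: "real mat" where "E = four_block_mat B1 B2 B3 B4"
abbreviation tilt :: "nat \<Rightarrow> real mat" where "tilt \<equiv> sylvester_sum N B3 S"

lemma FE_carrier [simp]: "F \<in> carrier_mat (r + k) (r + k)" "E \<in> carrier_mat (r + k) (r + k)"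
  using blocks by (auto simp: F_def E_def)

text \<open>Only the lower left block of the infinitesimal part matters, and it obeys a recursion of its own,
  \<open>L\<^sub>j\<^sub>+\<^sub>1 = N\<^sup>j B\<^sub>3 + L\<^sub>j T\<close>: because the standard part is block upper triangular, the other blocks of
  the infinitesimal parts never enter it.\<close>
lemma dual_pow_blocks:
  "\<exists>P2 Q1 Q2 Q4. P2 \<in> carrier_mat r k \<and> Q1 \<in> carrier_mat r r \<and> Q2 \<in> carrier_mat r k \<and>
     Q4 \<in> carrier_mat k k \<and>
     (F +\<^sub>\<epsilon> E) ^\<^sub>\<epsilon> j = four_block_mat (T ^\<^sub>m j) P2 (0\<^sub>m k r) (N ^\<^sub>m j) +\<^sub>\<epsilon>
       four_block_mat Q1 Q2 (tilt j * T ^\<^sub>m j) Q4"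
proof (induction j)
  case 0
  have "dim_row T = r" "dim_row N = k" "dim_row F = r + k" by (fact carrier_matD(1)[OF blocks(1)] carrier_matD(1)[OF blocks(3)]
        carrier_matD(1)[OF FE_carrier(1)])+
  moreover have "tilt 0 * T ^\<^sub>m 0 = 0\<^sub>m k r"
    using blocks carrier_matD[OF blocks(1)] carrier_matD[OF blocks(6)] by simp
  ultimately show ?case
    by (intro exI[of _ "0\<^sub>m r k"] exI[of _ "0\<^sub>m r r"] exI[of _ "0\<^sub>m k k"])
      (simp add: dual_one_def del: sylvester_sum.simps)
next
  case (Suc j)
  then obtain P2 Q1 Q2 Q4 where c: "P2 \<in> carrier_mat r k" "Q1 \<in> carrier_mat r r"
      "Q2 \<in> carrier_mat r k" "Q4 \<in> carrier_mat k k"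
    and IH: "(F +\<^sub>\<epsilon> E) ^\<^sub>\<epsilon> j = four_block_mat (T ^\<^sub>m j) P2 (0\<^sub>m k r) (N ^\<^sub>m j) +\<^sub>\<epsilon>
       four_block_mat Q1 Q2 (tilt j * T ^\<^sub>m j) Q4"
    by blast
  define L where "L = tilt j * T ^\<^sub>m j"
  have pows: "T ^\<^sub>m i \<in> carrier_mat r r" "N ^\<^sub>m i \<in> carrier_mat k k" "S ^\<^sub>m i \<in> carrier_mat r r" for i
    using blocks by (simp_all add: pow_carrier_mat)
  have L: "L \<in> carrier_mat k r" using pows by (simp add: L_def block_mult_carrier)
  note carriers = blocks c pows L
  have tilt_Suc: "tilt (Suc j) * T ^\<^sub>m Suc j = N ^\<^sub>m j * B3 + L * T"
  proof -
    have "N ^\<^sub>m j * B3 * S ^\<^sub>m Suc j * T ^\<^sub>m Suc j = N ^\<^sub>m j * B3"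
      using inverse_pow_mat[OF blocks(8,1) inverse(1), of "Suc j"] carriers
      by (simp add: assoc_mult_mat[of _ k r _ r _ r] block_mult_carrier right_mult_one_mat[of _ k r]
          del: pow_mat.simps)
    then have "tilt (Suc j) * T ^\<^sub>m Suc j = tilt j * T ^\<^sub>m Suc j + N ^\<^sub>m j * B3"
      using carriers
      by (simp add: add_mult_distrib_mat[of _ k r _ _ r] block_mult_carrier del: pow_mat.simps)
    also have "tilt j * T ^\<^sub>m Suc j = L * T"
      using carriers by (simp add: L_def assoc_mult_mat[of _ k r _ r _ r])
    finally show ?thesis
      using carriers by (simp add: comm_add_mat[of _ k r] block_mult_carrier)
  qed
  have std: "four_block_mat (T ^\<^sub>m j) P2 (0\<^sub>m k r) (N ^\<^sub>m j) * F
    = four_block_mat (T ^\<^sub>m Suc j) (T ^\<^sub>m j * T2 + P2 * N) (0\<^sub>m k r) (N ^\<^sub>m Suc j)"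
    using carriers unfolding F_def
    by (subst block_mult) (auto simp: block_mult_carrier right_mult_zero_mat[of _ _ k]
        left_mult_zero_mat[of _ r] intro!: cong_four_block_mat)
  have inf: "four_block_mat (T ^\<^sub>m j) P2 (0\<^sub>m k r) (N ^\<^sub>m j) * E + four_block_mat Q1 Q2 L Q4 * F
    = four_block_mat (T ^\<^sub>m j * B1 + P2 * B3 + (Q1 * T + Q2 * 0\<^sub>m k r))
        (T ^\<^sub>m j * B2 + P2 * B4 + (Q1 * T2 + Q2 * N))
        (tilt (Suc j) * T ^\<^sub>m Suc j)
        (0\<^sub>m k r * B2 + N ^\<^sub>m j * B4 + (L * T2 + Q4 * N))"
    unfolding tilt_Suc F_def E_def using carriers
    by (subst (1 2) block_mult) (simp_all add: block_mult_carrier block_add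
        left_mult_zero_mat[of _ r r] right_mult_zero_mat[of Q4 k k])
  have "(F +\<^sub>\<epsilon> E) ^\<^sub>\<epsilon> Suc j
    = four_block_mat (T ^\<^sub>m Suc j) (T ^\<^sub>m j * T2 + P2 * N) (0\<^sub>m k r) (N ^\<^sub>m Suc j) +\<^sub>\<epsilon>
      four_block_mat (T ^\<^sub>m j * B1 + P2 * B3 + (Q1 * T + Q2 * 0\<^sub>m k r))
        (T ^\<^sub>m j * B2 + P2 * B4 + (Q1 * T2 + Q2 * N))
        (tilt (Suc j) * T ^\<^sub>m Suc j)
        (0\<^sub>m k r * B2 + N ^\<^sub>m j * B4 + (L * T2 + Q4 * N))"
    by (simp only: dual_pow.simps(2) IH dual_mult.simps std inf L_def[symmetric])
  moreover have "T ^\<^sub>m j * T2 + P2 * N \<in> carrier_mat r k"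
    "T ^\<^sub>m j * B1 + P2 * B3 + (Q1 * T + Q2 * 0\<^sub>m k r) \<in> carrier_mat r r"
    "T ^\<^sub>m j * B2 + P2 * B4 + (Q1 * T2 + Q2 * N) \<in> carrier_mat r k"
    "0\<^sub>m k r * B2 + N ^\<^sub>m j * B4 + (L * T2 + Q4 * N) \<in> carrier_mat k k"
    using carriers by (simp_all add: block_mult_carrier)
  ultimately show ?case by blast
qed


lemma std_projection:
  "F * four_block_mat S (0\<^sub>m r k) (0\<^sub>m k r) (0\<^sub>m k k)
    = four_block_mat (1\<^sub>m r) (0\<^sub>m r k) (0\<^sub>m k r) (0\<^sub>m k k)"
  unfolding F_def using blocks inverse
  by (subst block_mult) (simp_all add: right_mult_zero_mat[of _ _ k] right_mult_zero_mat[of _ _ r]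
      left_mult_zero_mat[of _ r r] block_mult_carrier)

context
  fixes m :: nat
  assumes nilpotent: "N ^\<^sub>m m = 0\<^sub>m k k"
begin

text \<open>Nilpotency enters here: the lower rows of \<open>F\<^sup>m\<close> vanish, so that the product of the
  candidate with \<open>F\<close>, whose left blocks are those of \<open>diag(1, 0)\<close>, fixes it.\<close>
lemma std_core_EP_inverse:
  "real_mat.core_EP_inverse (r + k) m F (four_block_mat S (0\<^sub>m r k) (0\<^sub>m k r) (0\<^sub>m k k))"
proof -
  let ?G = "four_block_mat S (0\<^sub>m r k) (0\<^sub>m k r) (0\<^sub>m k k)"
  have G: "?G \<in> carrier_mat (r + k) (r + k)" using blocks by simp
  have "F * (?G * ?G) = F * ?G * ?G"
    using G by (simp add: assoc_mult_mat[of _ "r + k" "r + k" _ "r + k" _ "r + k"])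
  also have "\<dots> = ?G"
    unfolding std_projection using blocks
    by (subst block_mult) (simp_all add: right_mult_zero_mat[of _ _ k] right_mult_zero_mat[of _ _ r]
        left_mult_zero_mat[of _ r r] left_mult_one_mat[of _ r])
  finally have outer: "F * (?G * ?G) = ?G" .
  obtain P2 Q1 Q2 Q4 where P2: "P2 \<in> carrier_mat r k"
    and pow: "(F +\<^sub>\<epsilon> E) ^\<^sub>\<epsilon> m = four_block_mat (T ^\<^sub>m m) P2 (0\<^sub>m k r) (N ^\<^sub>m m) +\<^sub>\<epsilon>
       four_block_mat Q1 Q2 (tilt m * T ^\<^sub>m m) Q4"
    using dual_pow_blocks[of m] by blast
  have Fm: "F ^\<^sub>m m = four_block_mat (T ^\<^sub>m m) P2 (0\<^sub>m k r) (0\<^sub>m k k)"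
    using arg_cong[OF pow, of std_part] by (simp add: std_part_dual_pow nilpotent)
  have Tm: "T ^\<^sub>m m \<in> carrier_mat r r" using blocks by (simp add: pow_carrier_mat)
  have G_F: "?G * F = four_block_mat (1\<^sub>m r) (S * T2) (0\<^sub>m k r) (0\<^sub>m k k)"
    unfolding F_def using blocks inverse
    by (subst block_mult) (simp_all add: left_mult_zero_mat[of _ k] left_mult_zero_mat[of _ r]
        block_mult_carrier)
  have "?G * F ^\<^sub>m Suc m = ?G * F * F ^\<^sub>m m"
    unfolding pow_mat_Suc_left[OF FE_carrier(1)] using G
    by (simp add: assoc_mult_mat[of _ "r + k" "r + k" _ "r + k" _ "r + k"] pow_carrier_mat)
  also have "\<dots> = F ^\<^sub>m m"
    unfolding Fm G_F using blocks P2 Tm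
    by (subst block_mult) (simp_all add: left_mult_zero_mat[of _ k] left_mult_zero_mat[of _ r]
        right_mult_zero_mat[of _ r k] left_mult_one_mat[of _ r] block_mult_carrier)
  finally have "?G * F ^\<^sub>m Suc m = F ^\<^sub>m m" .
  then show ?thesis
    unfolding real_core_EP_inverse_iff[OF FE_carrier(1)]
    using G outer
    by (simp add: std_projection transpose_four_block_mat[of _ r r _ k _ k] del: pow_mat.simps)
qed

text \<open>Every block of the infinitesimal part is forced by one of the identities for the projection
  \<open>P = \<A>X\<close>. The lower left block of the infinitesimal part \<open>D\<close> of \<open>P\<close> is the tilt of its range away
  from the span of the first \<open>r\<close> unit vectors; its upper right block is the
  transpose, and its diagonal blocks vanish.\<close>
lemma dual_core_EP_inverse_block:
  assumes X: "dual_mat.core_EP_inverse (r + k) m (F +\<^sub>\<epsilon> E) X"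
  shows "X = four_block_mat S (0\<^sub>m r k) (0\<^sub>m k r) (0\<^sub>m k k) +\<^sub>\<epsilon>
    four_block_mat (- (S * B1 * S) - S * T2 * (tilt m * S)) (S * transpose_mat (tilt m))
      (tilt m * S) (0\<^sub>m k k)"
proof -
  let ?n = "r + k"
  let ?A = "F +\<^sub>\<epsilon> E"
  let ?G = "four_block_mat S (0\<^sub>m r k) (0\<^sub>m k r) (0\<^sub>m k k)"
  let ?P = "four_block_mat (1\<^sub>m r) (0\<^sub>m r k) (0\<^sub>m k r) (0\<^sub>m k k)"
  have A: "?A \<in> dual_carrier_mat ?n" by simp
  have X_carrier: "X \<in> dual_carrier_mat ?n"
    using X dual_core_EP_inverse_iff[OF A] by blast
  have "std_part X = ?G"
    using real_mat.core_EP_inverse_unique[OF std_part_core_EP_inverse[OF A X]] std_core_EP_inverse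
    by simp
  then obtain H where XH: "X = ?G +\<^sub>\<epsilon> H" and H: "H \<in> carrier_mat ?n ?n"
    using X_carrier by (auto elim!: dual_carrier_matE)
  obtain H1 H2 H3 H4 where H_eq: "H = four_block_mat H1 H2 H3 H4"
    and Hc: "H1 \<in> carrier_mat r r" "H2 \<in> carrier_mat r k" "H3 \<in> carrier_mat k r" "H4 \<in> carrier_mat k k"
    using H by (rule four_block_matE)
  define D where "D = F * H + E * ?G"
  have P_eq: "?A *\<^sub>\<epsilon> X = ?P +\<^sub>\<epsilon> D" by (simp add: XH D_def std_projection)
  have D_blocks: "D = four_block_mat (T * H1 + T2 * H3 + B1 * S) (T * H2 + T2 * H4)
      (N * H3 + B3 * S) (N * H4)"
    unfolding D_def F_def E_def H_eq using blocks Hc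
    by (subst (1 2) block_mult) (simp_all add: block_mult_carrier block_add
        right_mult_zero_mat[of _ _ k] right_mult_zero_mat[of _ _ r] left_mult_zero_mat[of _ r])
  then obtain D1 D2 D3 D4 where D_eq: "D = four_block_mat D1 D2 D3 D4"
    and D1: "D1 = T * H1 + T2 * H3 + B1 * S"
    and Dc: "D1 \<in> carrier_mat r r" "D2 \<in> carrier_mat r k" "D3 \<in> carrier_mat k r" "D4 \<in> carrier_mat k k"
    using blocks Hc by (simp add: block_mult_carrier)
  note zero_simps = right_mult_zero_mat[of _ _ k] right_mult_zero_mat[of _ _ r]
    left_mult_zero_mat[of _ k] left_mult_zero_mat[of _ r]
    left_mult_one_mat[of _ r] right_mult_one_mat[of _ _ r]

  \<comment> \<open>Idempotence of \<open>P\<close>: the diagonal blocks of \<open>D\<close> vanish.\<close>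
  have "(?A *\<^sub>\<epsilon> X) *\<^sub>\<epsilon> (?A *\<^sub>\<epsilon> X) = ?A *\<^sub>\<epsilon> X"
    using dual_mat.core_EP_projection_idem[OF X] by (simp only: dual_mat_monoid_simps)
  then have "?P * D + D * ?P = D" by (simp add: P_eq)
  then have "four_block_mat (D1 + D1) D2 D3 (0\<^sub>m k k) = four_block_mat D1 D2 D3 D4"
    unfolding D_eq using Dc by (subst (asm) (1 2) block_mult) (simp_all add: zero_simps block_add)
  note idem = four_block_mat_inject[OF this _ _ _ _ Dc]
  have "D1 + D1 = D1" "D4 = 0\<^sub>m k k" using idem Dc by simp_all
  have D1_zero: "D1 = 0\<^sub>m r r"
  proof (rule eq_matI)
    fix i j assume "i < dim_row (0\<^sub>m r r :: real mat)" "j < dim_col (0\<^sub>m r r :: real mat)"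
    then show "D1 $$ (i, j) = 0\<^sub>m r r $$ (i, j)"
      using arg_cong[OF \<open>D1 + D1 = D1\<close>, of "\<lambda>M. M $$ (i, j)"] Dc by simp
  qed (use Dc in simp_all)

  \<comment> \<open>Symmetry of \<open>P\<close> leaves a single unknown block, \<open>D3\<close>.\<close>
  have "dual_transpose (?A *\<^sub>\<epsilon> X) = ?A *\<^sub>\<epsilon> X"
    using dual_core_EP_inverse_iff[OF A] X by blast
  then have "four_block_mat (transpose_mat D1) (transpose_mat D3) (transpose_mat D2) (transpose_mat D4)
      = four_block_mat D1 D2 D3 D4"
    using Dc by (simp add: P_eq D_eq transpose_four_block_mat[of _ r r _ k _ k])
  from four_block_mat_inject(2)[OF this _ _ _ _ Dc] have D2: "D2 = transpose_mat D3"
    using Dc by simp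

  obtain P2 Q1 Q2 Q4 where c: "P2 \<in> carrier_mat r k" "Q1 \<in> carrier_mat r r"
      "Q2 \<in> carrier_mat r k" "Q4 \<in> carrier_mat k k"
    and pow: "?A ^\<^sub>\<epsilon> m = four_block_mat (T ^\<^sub>m m) P2 (0\<^sub>m k r) (0\<^sub>m k k) +\<^sub>\<epsilon>
       four_block_mat Q1 Q2 (tilt m * T ^\<^sub>m m) Q4"
    using dual_pow_blocks[of m] nilpotent by auto
  have Tm: "T ^\<^sub>m m \<in> carrier_mat r r" "S ^\<^sub>m m \<in> carrier_mat r r"
    using blocks by (simp_all add: pow_carrier_mat)
  define L where "L = tilt m * T ^\<^sub>m m"
  have L: "L \<in> carrier_mat k r" using Tm by (simp add: L_def block_mult_carrier)
  \<comment> \<open>\<open>P\<close> fixes \<open>\<A>\<^sup>m\<close>, whose first block column determines \<open>D3\<close> as \<open>T\<^sup>m\<close> is invertible.\<close>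
  have "(?A *\<^sub>\<epsilon> X) *\<^sub>\<epsilon> ?A ^\<^sub>\<epsilon> m = ?A ^\<^sub>\<epsilon> m"
    using dual_mat.core_EP_projection_power[OF X]
    by (simp only: dual_mat_monoid_simps dual_pow_eq_monoid_pow[OF A])
  then have "?P * four_block_mat Q1 Q2 L Q4 + D * four_block_mat (T ^\<^sub>m m) P2 (0\<^sub>m k r) (0\<^sub>m k k)
      = four_block_mat Q1 Q2 L Q4"
    by (simp add: P_eq pow L_def)
  then have "four_block_mat (Q1 + D1 * T ^\<^sub>m m) (Q2 + D1 * P2) (D3 * T ^\<^sub>m m) (D3 * P2)
      = four_block_mat Q1 Q2 L Q4"
    unfolding D_eq using Dc c Tm L
    by (subst (asm) (1 2) block_mult) (simp_all add: zero_simps block_add block_mult_carrier)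
  from four_block_mat_inject(3)[OF this _ _ _ _ c(2,3) L c(4)]
  have D3_pow: "D3 * T ^\<^sub>m m = tilt m * T ^\<^sub>m m"
    using Dc c Tm by (simp add: block_mult_carrier L_def)
  have cancel: "M * T ^\<^sub>m m * S ^\<^sub>m m = M" if "M \<in> carrier_mat k r" for M
    using that Tm inverse_pow_mat[OF blocks(1,8) inverse(2), of m]
    by (simp add: assoc_mult_mat[of _ k r _ r _ r] right_mult_one_mat[of _ k r])
  have D3: "D3 = tilt m"
    using arg_cong[OF D3_pow, of "\<lambda>M. M * S ^\<^sub>m m"] cancel[OF Dc(3)] cancel[of "tilt m"] by simp

  \<comment> \<open>\<open>P X = X\<close> determines the lower blocks of \<open>H\<close>, \<open>X P = X\<close> the upper right one, and \<open>D1 = 0\<close>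
    the upper left one.\<close>
  have "(?P +\<^sub>\<epsilon> D) *\<^sub>\<epsilon> X = X"
    using dual_mat.core_EP_projection_mult[OF X] by (simp only: dual_mat_monoid_simps P_eq)
  then have "?P * H + D * ?G = H" by (simp add: XH)
  then have "four_block_mat (H1 + D1 * S) H2 (D3 * S) (0\<^sub>m k k) = four_block_mat H1 H2 H3 H4"
    unfolding D_eq H_eq using Dc Hc blocks(8)
    by (subst (asm) (1 2) block_mult) (simp_all add: zero_simps block_add block_mult_carrier)
  note lower = four_block_mat_inject(3,4)[OF this _ _ _ _ Hc]
  have H3: "H3 = tilt m * S" and H4: "H4 = 0\<^sub>m k k"
    using lower Dc Hc blocks(8) D3 by (simp_all add: block_mult_carrier)

  have "X *\<^sub>\<epsilon> (?P +\<^sub>\<epsilon> D) = X"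
    using dual_mat.core_EP_mult_projection[OF X] by (simp only: dual_mat_monoid_simps P_eq)
  then have "?G * D + H * ?P = H" by (simp add: XH)
  then have "four_block_mat (S * D1 + H1) (S * D2) H3 (0\<^sub>m k k) = four_block_mat H1 H2 H3 H4"
    unfolding D_eq H_eq using Dc Hc blocks(8)
    by (subst (asm) (1 2) block_mult) (simp_all add: zero_simps block_add block_mult_carrier)
  from four_block_mat_inject(2)[OF this _ _ _ _ Hc]
  have H2: "H2 = S * transpose_mat (tilt m)"
    using Dc Hc blocks(8) by (simp add: block_mult_carrier D2 D3)

  have "T * H1 + T2 * H3 + B1 * S = 0\<^sub>m r r" using D1 D1_zero by simp
  moreover have "S * (T * H1) = H1"
    using assoc_mult_mat[OF blocks(8) blocks(1) Hc(1)] inverse(1) left_mult_one_mat[OF Hc(1)] by simp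
  then have "S * (T * H1 + T2 * H3 + B1 * S) = H1 + S * T2 * H3 + S * B1 * S"
    using blocks Hc
    by (simp add: mult_add_distrib_mat[of _ r r _ r] block_mult_carrier
        assoc_mult_mat[of _ r k _ _ _ r] assoc_mult_mat[of _ r r _ _ _ r])
  ultimately have "H1 + S * T2 * H3 + S * B1 * S = 0\<^sub>m r r"
    using right_mult_zero_mat[OF blocks(8), of r] by simp
  then have H1: "H1 = - (S * B1 * S) - S * T2 * H3"
  proof (intro eq_matI)
    fix i j
    assume eq: "H1 + S * T2 * H3 + S * B1 * S = 0\<^sub>m r r"
      and "i < dim_row (- (S * B1 * S) - S * T2 * H3)" "j < dim_col (- (S * B1 * S) - S * T2 * H3)"
    then have ij: "i < r" "j < r"
      using carrier_matD[OF blocks(8)] carrier_matD[OF Hc(3)] by simp_all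
    have "S * T2 * H3 \<in> carrier_mat r r" "S * B1 * S \<in> carrier_mat r r"
      using blocks Hc by (simp_all add: block_mult_carrier)
    then show "H1 $$ (i, j) = (- (S * B1 * S) - S * T2 * H3) $$ (i, j)"
      using arg_cong[OF eq, of "\<lambda>M. M $$ (i, j)"] ij Hc by (simp del: index_mult_mat)
  qed (use carrier_matD[OF blocks(8)] carrier_matD[OF Hc(1)] carrier_matD[OF Hc(3)] in simp_all)
  show ?thesis by (simp add: XH H_eq H1 H2 H3 H4)
qed

end

end

section \<open>Undoing the change of basis\<close>

lemma dual_conjugate:
  assumes "U \<in> carrier_mat n n" "V \<in> carrier_mat n n" "A \<in> carrier_mat n n" "B \<in> carrier_mat n n"
  shows "(V +\<^sub>\<epsilon> 0\<^sub>m n n) *\<^sub>\<epsilon> (A +\<^sub>\<epsilon> B) *\<^sub>\<epsilon> (U +\<^sub>\<epsilon> 0\<^sub>m n n) = V * A * U +\<^sub>\<epsilon> V * B * U"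
  using assms mult_carrier_mat[of _ n n _ n]
  by (simp add: left_mult_zero_mat[of _ n n] right_mult_zero_mat[of _ n n])

text \<open>Invertibility is stated with an inverse of unspecified dimensions; comparing the dimensions of
  the two products shows that it is square, so that Gauss-Jordan elimination finds an inverse.\<close>
lemma mat_inv_inverse:
  assumes A: "A \<in> carrier_mat n n" and inv: "invertible_mat A"
  shows "mat_inv A \<in> carrier_mat n n" "mat_inv A * A = 1\<^sub>m n" "A * mat_inv A = 1\<^sub>m n"
proof -
  obtain B where AB: "A * B = 1\<^sub>m n" and BA: "B * A = 1\<^sub>m (dim_row B)"
    using inv A by (auto simp: invertible_mat_def inverts_mat_def)
  have "dim_col B = n" using arg_cong[OF AB, of dim_col] by simp
  moreover have "dim_row B = n" using arg_cong[OF BA, of dim_col] A by simp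
  ultimately have "A \<in> Units (real_mat_ring n)"
    using AB BA A by (auto simp: Units_def ring_mat_simps intro!: bexI[of _ B])
  then obtain C where "mat_inverse A = Some C"
    using mat_inverse(1)[OF A, where b = "()"] by (cases "mat_inverse A") auto
  with mat_inverse(2)[OF A] show "mat_inv A \<in> carrier_mat n n" "mat_inv A * A = 1\<^sub>m n"
    "A * mat_inv A = 1\<^sub>m n"
    by (auto simp: mat_inv_def)
qed

lemma nilpotent_mat_pow_index:
  assumes "nilpotent_mat N"
  shows "N ^\<^sub>m nilpotency_index N = 0\<^sub>m (dim_row N) (dim_row N)"
  using assms unfolding nilpotent_mat_def nilpotency_index_def by (metis (mono_tags, lifting) LeastI)

theorem theorem4p7:
  fixes A B U T1 T2 N B1 B2 B3 B4 :: "real mat" and n m r :: nat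
  assumes A: "A \<in> carrier_mat n n" and B: "B \<in> carrier_mat n n"
    and index: "mat_index A = m"
    and r: "r = vec_space.rank n (A ^\<^sub>m m)"
    and U: "U \<in> carrier_mat n n" "real_unitary_mat U"
    and T1: "T1 \<in> carrier_mat r r" "invertible_mat T1"
    and T2: "T2 \<in> carrier_mat r (n - r)"
    and N: "N \<in> carrier_mat (n - r) (n - r)" "nilpotent_mat N" "nilpotency_index N = m"
    and B1: "B1 \<in> carrier_mat r r"
    and B2: "B2 \<in> carrier_mat r (n - r)"
    and B3: "B3 \<in> carrier_mat (n - r) r"
    and B4: "B4 \<in> carrier_mat (n - r) (n - r)"
    and A_decomp: "A = U * four_block_mat T1 T2 (0\<^sub>m (n - r) r) N * transpose_mat U"
    and B_decomp: "B = U * four_block_mat B1 B2 B3 B4 * transpose_mat U"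
    and ex: "\<exists>X. is_dual_core_EP_inverse (A +\<^sub>\<epsilon> B) X"
  shows "dual_core_EP_inverse (A +\<^sub>\<epsilon> B) =
    (U * four_block_mat (mat_inv T1) (0\<^sub>m r (n - r)) (0\<^sub>m (n - r) r) (0\<^sub>m (n - r) (n - r))
       * transpose_mat U
     +\<^sub>\<epsilon>
     U * four_block_mat
           (- (mat_inv T1 * B1 * mat_inv T1)
             - mat_inv T1 * T2 *
                 (\<Oplus>\<^bsub>module_mat TYPE(real) (n - r) r\<^esub> i \<in> {1..m}.
                    N ^\<^sub>m (m - i) * B3 * mat_powi T1 (int i - int m - 2)))
           (mat_inv T1 *
              transpose_mat (\<Oplus>\<^bsub>module_mat TYPE(real) (n - r) r\<^esub> i \<in> {1..m}.
                    N ^\<^sub>m (m - i) * B3 * mat_powi T1 (int i - int m - 1)))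
           (\<Oplus>\<^bsub>module_mat TYPE(real) (n - r) r\<^esub> i \<in> {1..m}.
                    N ^\<^sub>m (m - i) * B3 * mat_powi T1 (int i - int m - 2))
           (0\<^sub>m (n - r) (n - r))
       * transpose_mat U)"
proof -
  define k where "k = n - r"
  define S where "S = mat_inv T1"
  have "r \<le> n"
    unfolding r by (rule vec_space.rank_le_nc) (use A in \<open>simp add: pow_carrier_mat\<close>)
  then have n: "n = r + k" by (simp add: k_def)
  interpret dual_block k r T1 T2 N B1 B2 B3 B4 S
    using T1 T2 N(1) B1 B2 B3 B4 mat_inv_inverse[OF T1]
    by unfold_locales (simp_all add: k_def S_def)
  have nilp: "N ^\<^sub>m m = 0\<^sub>m k k"
    using nilpotent_mat_pow_index[OF N(2)] N(1,3) by (simp add: k_def)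

  \<comment> \<open>The summands of the theorem, written with natural exponents of \<open>S\<close>, the inverse of \<open>T1\<close>.\<close>
  interpret M: abelian_group "module_mat TYPE(real) k r" by (rule abelian_group_mat)
  have powi: "mat_powi T1 (int i - int m - 1) = S ^\<^sub>m Suc (m - i)"
    "mat_powi T1 (int i - int m - 2) = S ^\<^sub>m Suc (Suc (m - i))" if "i \<in> {1..m}" for i
  proof -
    have "nat (- (int i - int m - 1)) = Suc (m - i)" "nat (- (int i - int m - 2)) = Suc (Suc (m - i))"
      using that by auto
    then show "mat_powi T1 (int i - int m - 1) = S ^\<^sub>m Suc (m - i)"
      "mat_powi T1 (int i - int m - 2) = S ^\<^sub>m Suc (Suc (m - i))"
      using that by (simp_all only: mat_powi_def S_def) auto
  qed
  have term_carrier: "N ^\<^sub>m j * B3 * S ^\<^sub>m j' \<in> carrier_mat k r" for j j'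
    using blocks by (simp add: block_mult_carrier pow_carrier_mat)
  have sum1: "(\<Oplus>\<^bsub>module_mat TYPE(real) k r\<^esub> i \<in> {1..m}.
      N ^\<^sub>m (m - i) * B3 * mat_powi T1 (int i - int m - 1)) = tilt m"
    unfolding finsum_eq_sylvester_sum[symmetric]
    by (rule M.finsum_cong') (use term_carrier in \<open>simp_all only: powi module_mat_simps Pi_I\<close>)
  have sum2: "(\<Oplus>\<^bsub>module_mat TYPE(real) k r\<^esub> i \<in> {1..m}.
      N ^\<^sub>m (m - i) * B3 * mat_powi T1 (int i - int m - 2)) = tilt m * S"
    unfolding finsum_eq_sylvester_sum_mult[symmetric]
    by (rule M.finsum_cong') (use term_carrier in \<open>simp_all only: powi module_mat_simps Pi_I\<close>)

  define V where "V = transpose_mat U"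
  have V: "V \<in> carrier_mat n n" and UV: "U * V = 1\<^sub>m n" "V * U = 1\<^sub>m n"
    using U by (auto simp: V_def real_unitary_mat_def inverts_mat_def)
  \<comment> \<open>The orthogonal matrix \<open>U\<close>, seen as a dual matrix, reduces the claim to the block form.\<close>
  let ?u = "U +\<^sub>\<epsilon> 0\<^sub>m n n" and ?v = "V +\<^sub>\<epsilon> 0\<^sub>m n n"
  have uv: "?u \<in> carrier (dual_mat_monoid n)" "?v \<in> carrier (dual_mat_monoid n)"
    "?u \<otimes>\<^bsub>dual_mat_monoid n\<^esub> ?v = \<one>\<^bsub>dual_mat_monoid n\<^esub>"
    "?v \<otimes>\<^bsub>dual_mat_monoid n\<^esub> ?u = \<one>\<^bsub>dual_mat_monoid n\<^esub>"
    and star: "?v = dual_transpose ?u"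
    using U(1) V UV
    by (simp_all add: dual_mat_monoid_simps dual_one_def left_mult_zero_mat[of _ n n]
        right_mult_zero_mat[of _ n n] V_def)
  have cancel: "V * (U * M * V) * U = M" "U * (V * M * U) * V = M" if "M \<in> carrier_mat n n" for M
  proof -
    note [simp] = mult_carrier_mat[of _ n n _ n]
    have "V * (U * M * V) * U = (V * U) * M * (V * U)" "U * (V * M * U) * V = (U * V) * M * (U * V)"
      using that U(1) V by (simp_all add: assoc_mult_mat[of _ n n _ n _ n])
    then show "V * (U * M * V) * U = M" "U * (V * M * U) * V = M"
      using that by (simp_all add: UV left_mult_one_mat[of _ n n] right_mult_one_mat[of _ n n])
  qed
  have FE: "F \<in> carrier_mat n n" "E \<in> carrier_mat n n" by (simp_all add: n)
  have A_eq: "A = U * F * V" and B_eq: "B = U * E * V"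
    by (simp_all only: A_decomp B_decomp F_def E_def V_def flip: k_def)

  let ?G = "four_block_mat S (0\<^sub>m r k) (0\<^sub>m k r) (0\<^sub>m k k)"
  let ?H = "four_block_mat (- (S * B1 * S) - S * T2 * (tilt m * S)) (S * transpose_mat (tilt m))
    (tilt m * S) (0\<^sub>m k k)"
  have formula: "X = U * ?G * V +\<^sub>\<epsilon> U * ?H * V" if "is_dual_core_EP_inverse (A +\<^sub>\<epsilon> B) X" for X
  proof -
    have X: "dual_mat.core_EP_inverse n m (A +\<^sub>\<epsilon> B) X"
      using that is_dual_core_EP_inverse_iff[OF A B] index by simp
    then obtain X0 X1 where X_eq: "X = X0 +\<^sub>\<epsilon> X1"
      and Xc: "X0 \<in> carrier_mat n n" "X1 \<in> carrier_mat n n"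
      using dual_mat.core_EP_closed(2)[OF X]
      by (auto simp: dual_mat_monoid_simps elim!: dual_carrier_matE)
    have "dual_mat.core_EP_inverse n m (F +\<^sub>\<epsilon> E) (V * X0 * U +\<^sub>\<epsilon> V * X1 * U)"
      using dual_mat.core_EP_inverse_conjugate[OF uv star X]
      by (simp only: dual_mat_monoid_simps X_eq dual_conjugate[OF U(1) V] A B Xc)
        (simp only: A_eq B_eq cancel FE)
    from dual_core_EP_inverse_block[OF nilp this[unfolded n]]
    have "V * X0 * U = ?G" "V * X1 * U = ?H" by simp_all
    then show ?thesis
      using cancel(2)[OF Xc(1)] cancel(2)[OF Xc(2)] by (simp add: X_eq)
  qed
  from ex obtain X where X: "is_dual_core_EP_inverse (A +\<^sub>\<epsilon> B) X" by blast
  have "dual_core_EP_inverse (A +\<^sub>\<epsilon> B) = U * ?G * V +\<^sub>\<epsilon> U * ?H * V"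
    unfolding dual_core_EP_inverse_def
    using X formula[OF X] by (intro the_equality) (simp, rule formula)
  then show ?thesis
    unfolding k_def[symmetric] sum1 sum2 S_def[symmetric] V_def[symmetric] .
qed

end
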